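(* Let $\{X_t:t\ge0\}$ be a $d$-dimensional Lévy process and let $b:[0,1]\to[0,1]$ be continuous and increasing with $b(1)=1$, $b(t)/t\to\infty$ as $t\to0$, such that on some interval $[0,t_0]$: (i) $b(t)/t^\rho$ is non-decreasing for some $\rho>1/3$; (ii) for every $\varepsilon>0$ there is $0<\delta_\varepsilon<t_0$ with $b(s)/b(t)\ge(1-\varepsilon)s/t$ for $0\le s\le t\le\delta_\varepsilon$. Assume that for every $\delta>0$ there exist $K_\delta>0$ and $0<t_\delta<1$ with $\mathbb{P}\{|X_t|>K_\delta b(t)\}<\delta$ for $0<t<t_\delta$. Given $x\in\mathbb{R}^d$, the following are equivalent: (a) with probability one, $x\in C(\{X_t/b(t):t\downarrow0\})$; (b) $\int_0^1t^{-1}\mathbb{P}\{|X_t/b(t)-x|<\varepsilon\}\,dt=\infty$ for all $\varepsilon>0$.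
   Context: $|\cdot|$ is the Euclidean norm. The cluster set $C(\{X_t/b(t):t\downarrow0\})$ is the (random) set of all limit points of $X_{t_n}/b(t_n)$ along sequences $t_n\downarrow0$. *)

theory Defs
  imports "HOL-Probability.Probability"
begin

definition levy_process :: "'a measure \<Rightarrow> (real \<Rightarrow> 'a \<Rightarrow> 'b::euclidean_space) \<Rightarrow> bool" where
  "levy_process M X \<longleftrightarrow>
     prob_space M
   \<and> (\<forall>t\<ge>0. X t \<in> borel_measurable M)
   \<and> (AE \<omega> in M. X 0 \<omega> = 0)
   \<and> (\<forall>(n::nat) (s::nat \<Rightarrow> real). 0 \<le> s 0 \<and> (\<forall>i<n. s i < s (Suc i)) \<longrightarrow>
        prob_space.indep_vars M (\<lambda>_. borel) (\<lambda>i \<omega>. X (s (Suc i)) \<omega> - X (s i) \<omega>) {..<n})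
   \<and> (\<forall>s t. 0 \<le> s \<longrightarrow> 0 \<le> t \<longrightarrow>
        distr M borel (\<lambda>\<omega>. X (s + t) \<omega> - X s \<omega>) = distr M borel (X t))
   \<and> (AE \<omega> in M. \<forall>t\<ge>0. continuous (at_right t) (\<lambda>s. X s \<omega>)
        \<and> (0 < t \<longrightarrow> (\<exists>l. ((\<lambda>s. X s \<omega>) \<longlongrightarrow> l) (at_left t))))"

definition cluster_set_at0 :: "(real \<Rightarrow> 'b::topological_space) \<Rightarrow> 'b set" where
  "cluster_set_at0 f = {x. \<exists>t::nat \<Rightarrow> real. (\<forall>n. 0 < t n) \<and> t \<longlonglongrightarrow> 0
                           \<and> (\<lambda>n. f (t n)) \<longlonglongrightarrow> x}"

end

theory Submission
  imports Defs
begin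

text \<open>
  Write \<open>p e t\<close> for the probability that \<open>X t / b t\<close> lies within \<open>e\<close> of \<open>x\<close>.

  If the integral of \<open>p (3 * e) t / t\<close> is finite: once \<open>X t / b t\<close> is within \<open>e\<close> of \<open>x\<close>, the
  regularity of \<open>b\<close> and tightness keep \<open>X w / b w\<close> within \<open>3 * e\<close> of \<open>x\<close> with probability at least
  \<open>1/2\<close>, for each later \<open>w\<close> with \<open>w / t\<close> close to \<open>1\<close>. Hence the probability of an \<open>e\<close>-hit in a
  short geometric interval is at most \<open>2 * p (3 * e) w\<close> for every \<open>w\<close> in the next interval, these
  probabilities are summable, and Borel-Cantelli applies.

  If the integrals all diverge: pick from geometric intervals times \<open>v k\<close> at which \<open>p e\<close> is at least
  half its supremum, thinned so that \<open>v (Suc k) \<le> c * v k\<close>, with divergent sum of \<open>p e (v k)\<close>. For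
  \<open>T k = v k + v (Suc k) + \<dots>\<close> the increments over \<open>T (Suc k)\<close> to \<open>T k\<close> are independent and
  distributed as \<open>X (v k)\<close>, so almost surely one of them is close to \<open>b (v k) * x\<close>. Searching from
  the largest time downwards, the first success is independent of \<open>X (T (Suc k))\<close>, which is
  negligible against \<open>b (T k)\<close> with probability close to \<open>1\<close>.
\<close>

section \<open>Independence of increments of a Levy process\<close>

locale levy = prob_space M for M :: "'a measure" +
  fixes X :: "real \<Rightarrow> 'a \<Rightarrow> 'b::euclidean_space"
  assumes levy: "levy_process M X"
begin

lemma measurable_X [measurable]: "0 \<le> t \<Longrightarrow> X t \<in> borel_measurable M"
  using levy by (auto simp: levy_process_def)

lemma AE_X0: "AE \<omega> in M. X 0 \<omega> = 0"
  using levy by (auto simp: levy_process_def)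

lemma indep_increments:
  assumes "0 \<le> s (0::nat)" "\<And>i. i < n \<Longrightarrow> s i < s (Suc i)"
  shows "indep_vars (\<lambda>_. borel) (\<lambda>i \<omega>. X (s (Suc i)) \<omega> - X (s i) \<omega>) {..<n}"
  using levy assms by (auto simp: levy_process_def)

lemma prob_increment:
  assumes "0 \<le> s" "s \<le> t" and S: "S \<in> sets borel"
  shows "\<P>(\<omega> in M. X t \<omega> - X s \<omega> \<in> S) = \<P>(\<omega> in M. X (t - s) \<omega> \<in> S)"
proof -
  have "distr M borel (\<lambda>\<omega>. X (s + (t - s)) \<omega> - X s \<omega>) = distr M borel (X (t - s))"
    using levy assms unfolding levy_process_def by (metis diff_ge_0_iff_ge)
  then have "measure (distr M borel (\<lambda>\<omega>. X t \<omega> - X s \<omega>)) S = measure (distr M borel (X (t - s))) S"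
    by simp
  then show ?thesis
    using assms by (simp add: measure_distr vimage_def Int_def conj_commute)
qed

text \<open>Finite-dimensional Markov property. Up to \<open>X 0\<close>, the values of
  \<open>X\<close> on \<open>F\<close> are partial sums of the increments between consecutive points
  of \<open>F\<close>, and \<open>t\<close> is the largest of these points, so the increment from
  \<open>t\<close> to \<open>v\<close> is independent of them. This separates a first hit at
  \<open>t\<close> from what happens afterwards.\<close>

lemma prob_past_increment:
  assumes F: "finite F" "t \<in> F" "\<And>s. s \<in> F \<Longrightarrow> 0 < s \<and> s \<le> t" and "t < v"
    and Q: "\<And>s. Q s \<in> sets borel" and S: "S \<in> sets borel"
  shows "\<P>(\<omega> in M. (\<forall>s\<in>F. X s \<omega> \<in> Q s) \<and> X v \<omega> - X t \<omega> \<in> S) =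
    \<P>(\<omega> in M. \<forall>s\<in>F. X s \<omega> \<in> Q s) * \<P>(\<omega> in M. X (v - t) \<omega> \<in> S)"
proof -
  define l where "l = sorted_list_of_set F"
  define n where "n = length l"
  \<comment> \<open>The points of \<open>F\<close> in increasing order, framed by \<open>0\<close>
    and \<open>v\<close>: the increments with index below \<open>n\<close> determine the past, and
    the one with index \<open>n\<close> runs from \<open>t\<close> to \<open>v\<close>.\<close>
  define Z where "Z i = (0 # l @ [v]) ! i" for i
  define D where "D i \<omega> = X (Z (Suc i)) \<omega> - X (Z i) \<omega>" for i \<omega>
  have setl: "set l = F" and sl: "sorted_wrt (<) l"
    using F(1) by (auto simp: l_def)
  have "0 < n" using setl F(2) by (auto simp: n_def)
  have lpos: "0 < l ! i \<and> l ! i \<le> t" if "i < n" for i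
    using that F(3) setl by (metis n_def nth_mem)
  have last: "l ! (n - 1) = t"
  proof -
    obtain i where i: "i < n" "l ! i = t"
      using F(2) setl by (metis in_set_conv_nth n_def)
    have "\<not> i < n - 1"
      using sorted_wrt_nth_less[OF sl, of i "n - 1"] i lpos[of "n - 1"] by (force simp: n_def)
    then have "i = n - 1" using i by linarith
    then show ?thesis using i by simp
  qed
  have sZ: "sorted_wrt (<) (0 # l @ [v])"
    using sl F(3) \<open>t < v\<close> F(2) setl by (fastforce simp: sorted_wrt_append)
  have Z_Suc: "Z (Suc i) = l ! i" if "i < n" for i
    using that by (simp add: Z_def n_def nth_append)
  have Z: "Z n = t" "Z (Suc n) = v" "Z 0 = 0"
    using \<open>0 < n\<close> last by (auto simp: Z_def n_def nth_append nth_Cons')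
  have ind: "indep_vars (\<lambda>_. borel) D {..<Suc n}"
    unfolding D_def
  proof (rule indep_increments)
    show "Z i < Z (Suc i)" if "i < Suc n" for i
      unfolding Z_def by (rule sorted_wrt_nth_less[OF sZ]) (use that in \<open>auto simp: n_def\<close>)
  qed (simp add: Z)
  have tele: "(\<Sum>j\<le>i. D j \<omega>) = X (l ! i) \<omega> - X 0 \<omega>" if "i < n" for i \<omega>
  proof -
    have "(\<Sum>j\<le>i. D j \<omega>) = X (Z (Suc i)) \<omega> - X (Z 0) \<omega>"
      unfolding D_def lessThan_Suc_atMost[symmetric] by (rule sum_lessThan_telescope)
    then show ?thesis using Z Z_Suc that by simp
  qed
  have Dn: "D n \<omega> = X v \<omega> - X t \<omega>" for \<omega>
    by (simp add: D_def Z)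
  \<comment> \<open>Past and future become sets of increment tuples over disjoint groups of
    coordinates, the form in which grouped independence applies.\<close>
  define H where "H = {f \<in> space (PiM {..<n} (\<lambda>_. borel :: 'b measure)). \<forall>i\<in>{..<n}. (\<Sum>j\<le>i. f j) \<in> Q (l ! i)}"
  define G where "G = {f \<in> space (PiM {n} (\<lambda>_. borel :: 'b measure)). f n \<in> S}"
  have H: "H \<in> sets (PiM {..<n} (\<lambda>_. borel))"
  proof -
    have *: "(\<lambda>f. \<Sum>j\<le>i. f j) \<in> borel_measurable (PiM {..<n} (\<lambda>_. borel :: 'b measure))" if "i < n" for i
      using that by (intro borel_measurable_sum measurable_component_singleton) auto
    have "{f \<in> space (PiM {..<n} (\<lambda>_. borel :: 'b measure)). (\<Sum>j\<le>i. f j) \<in> Q (l ! i)} \<in> sets (PiM {..<n} (\<lambda>_. borel))"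
      if "i < n" for i
      using measurable_sets[OF *[OF that] Q[of "l ! i"]] by (simp add: vimage_def Int_def conj_commute)
    then show ?thesis
      unfolding H_def by (intro sets.sets_Collect_finite_All) auto
  qed
  have G: "G \<in> sets (PiM {n} (\<lambda>_. borel))"
    unfolding G_def using S by measurable
  have Fm: "s \<in> F \<Longrightarrow> X s \<in> borel_measurable M" for s
    using F(3)[of s] by simp
  have vm: "X v \<in> borel_measurable M" "X t \<in> borel_measurable M"
    using Fm[OF F(2)] \<open>t < v\<close> F by auto (smt (verit) measurable_X)
  note [measurable] = Q S vm
  have Fsets: "{\<omega> \<in> space M. \<forall>s\<in>F. X s \<omega> \<in> Q s} \<in> sets M"
    by (intro sets.sets_Collect_finite_All predE)
       (use F Fm Q in \<open>auto intro!: pred_sets1\<close>)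
  have Fsets0: "{\<omega> \<in> space M. \<forall>s\<in>F. X s \<omega> - X 0 \<omega> \<in> Q s} \<in> sets M"
    by (intro sets.sets_Collect_finite_All predE)
       (use F Fm Q in \<open>auto intro!: pred_sets1 borel_measurable_diff\<close>)
  have "prob ((\<lambda>\<omega>. (restrict (\<lambda>i. D i \<omega>) {..<n}, restrict (\<lambda>i. D i \<omega>) {n})) -` (H \<times> G) \<inter> space M) =
    prob ((\<lambda>\<omega>. restrict (\<lambda>i. D i \<omega>) {..<n}) -` H \<inter> space M) * prob ((\<lambda>\<omega>. restrict (\<lambda>i. D i \<omega>) {n}) -` G \<inter> space M)"
    by (rule indep_varD[OF indep_var_restrict[OF ind] H G]) auto
  also have "(\<lambda>\<omega>. restrict (\<lambda>i. D i \<omega>) {..<n}) -` H = {\<omega>. \<forall>s\<in>F. X s \<omega> - X 0 \<omega> \<in> Q s}"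
    unfolding setl[symmetric] by (auto simp: H_def space_PiM tele all_set_conv_all_nth n_def[symmetric] PiE_iff)
  also have "(\<lambda>\<omega>. restrict (\<lambda>i. D i \<omega>) {n}) -` G = {\<omega>. X v \<omega> - X t \<omega> \<in> S}"
    by (auto simp: G_def space_PiM Dn)
  also have "(\<lambda>\<omega>. (restrict (\<lambda>i. D i \<omega>) {..<n}, restrict (\<lambda>i. D i \<omega>) {n})) -` (H \<times> G) =
     {\<omega>. (\<forall>s\<in>F. X s \<omega> - X 0 \<omega> \<in> Q s) \<and> X v \<omega> - X t \<omega> \<in> S}"
    unfolding setl[symmetric] by (auto simp: H_def G_def space_PiM tele all_set_conv_all_nth n_def[symmetric] PiE_iff Dn)
  finally have eq: "\<P>(\<omega> in M. (\<forall>s\<in>F. X s \<omega> - X 0 \<omega> \<in> Q s) \<and> X v \<omega> - X t \<omega> \<in> S) =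
    \<P>(\<omega> in M. \<forall>s\<in>F. X s \<omega> - X 0 \<omega> \<in> Q s) * \<P>(\<omega> in M. X v \<omega> - X t \<omega> \<in> S)"
    by (simp add: Int_def conj_commute)
  have Ssets: "{\<omega> \<in> space M. X v \<omega> - X t \<omega> \<in> S} \<in> sets M" by measurable
  \<comment> \<open>The process starts at \<open>0\<close> only almost surely, so the identity is
    first obtained for \<open>X s - X 0\<close> and then transferred across a null set.\<close>
  have "\<P>(\<omega> in M. (\<forall>s\<in>F. X s \<omega> - X 0 \<omega> \<in> Q s) \<and> X v \<omega> - X t \<omega> \<in> S) =
    \<P>(\<omega> in M. (\<forall>s\<in>F. X s \<omega> \<in> Q s) \<and> X v \<omega> - X t \<omega> \<in> S)"
    using AE_X0 sets.sets_Collect_conj[OF Ssets Fsets] sets.sets_Collect_conj[OF Ssets Fsets0]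
    by (intro finite_measure_eq_AE) (auto simp: conj_commute)
  moreover have "\<P>(\<omega> in M. \<forall>s\<in>F. X s \<omega> - X 0 \<omega> \<in> Q s) = \<P>(\<omega> in M. \<forall>s\<in>F. X s \<omega> \<in> Q s)"
    using AE_X0 Fsets Fsets0 by (intro finite_measure_eq_AE) auto
  ultimately show ?thesis
    using eq prob_increment[of t v S] S F \<open>t < v\<close> by (smt (verit))
qed

text \<open>Since \<open>T\<close> decreases, \<open>X (T (Suc j))\<close> is almost surely the
  increment over the initial interval, and the others cover successive intervals up to
  \<open>T 0\<close>; all are independent, and stationarity leaves only their lengths in the
  product.\<close>

lemma prob_increments:
  fixes T :: "nat \<Rightarrow> real"
  assumes T: "\<And>k. 0 < T k" "\<And>k. T (Suc k) < T k"
    and S: "\<And>i. S i \<in> sets borel" and B: "B \<in> sets borel"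
  shows "\<P>(\<omega> in M. X (T (Suc j)) \<omega> \<in> B \<and> (\<forall>i\<le>j. X (T i) \<omega> - X (T (Suc i)) \<omega> \<in> S i)) =
    \<P>(\<omega> in M. X (T (Suc j)) \<omega> \<in> B) * (\<Prod>i\<le>j. \<P>(\<omega> in M. X (T i - T (Suc i)) \<omega> \<in> S i))"
proof -
  \<comment> \<open>The times are traversed backwards because independence is stated for increasing
    grids: the increment of index \<open>0\<close> runs from \<open>0\<close> to
    \<open>T (Suc j)\<close>, the one of index \<open>Suc (j - i)\<close> from
    \<open>T (Suc i)\<close> to \<open>T i\<close>.\<close>
  define s where "s i = (if i = 0 then 0 else T (Suc (Suc j) - i))" for i
  define D where "D i \<omega> = X (s (Suc i)) \<omega> - X (s i) \<omega>" for i \<omega>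
  define U where "U i = (if i = 0 then B else S (Suc j - i))" for i
  have ind: "indep_vars (\<lambda>_. borel) D {..<Suc (Suc j)}"
    unfolding D_def
  proof (rule indep_increments)
    show "s i < s (Suc i)" if "i < Suc (Suc j)" for i
      using that T(1)[of "Suc j"] T(2)[of "Suc j - i"] by (auto simp: s_def Suc_diff_le)
  qed (simp add: s_def)
  have "prob (\<Inter>i\<in>{..<Suc (Suc j)}. D i -` U i \<inter> space M) = (\<Prod>i\<in>{..<Suc (Suc j)}. prob (D i -` U i \<inter> space M))"
    by (rule indep_varsD_finite[OF ind]) (use S B in \<open>auto simp: U_def\<close>)
  also have "(\<Inter>i\<in>{..<Suc (Suc j)}. D i -` U i \<inter> space M) =
    {\<omega>\<in>space M. X (T (Suc j)) \<omega> - X 0 \<omega> \<in> B \<and> (\<forall>i\<le>j. X (T i) \<omega> - X (T (Suc i)) \<omega> \<in> S i)}"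
    (is "?L = ?R")
  proof -
    have *: "D (Suc (j - i)) \<omega> \<in> U (Suc (j - i)) \<longleftrightarrow> X (T i) \<omega> - X (T (Suc i)) \<omega> \<in> S i" if "i \<le> j" for i \<omega>
      using that by (simp add: D_def U_def s_def Suc_diff_le)
    show ?thesis
    proof (rule set_eqI)
      fix \<omega>
      have "\<omega> \<in> ?L \<longleftrightarrow> \<omega> \<in> space M \<and> D 0 \<omega> \<in> U 0 \<and> (\<forall>i\<le>j. D (Suc i) \<omega> \<in> U (Suc i))"
        using lessThan_Suc_eq_insert_0[of "Suc j"] by (auto simp: lessThan_Suc_atMost)
      also have "(\<forall>i\<le>j. D (Suc i) \<omega> \<in> U (Suc i)) \<longleftrightarrow> (\<forall>i\<le>j. D (Suc (j - i)) \<omega> \<in> U (Suc (j - i)))"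
        by (metis diff_diff_cancel diff_le_self)
      also have "\<dots> \<longleftrightarrow> (\<forall>i\<le>j. X (T i) \<omega> - X (T (Suc i)) \<omega> \<in> S i)"
        using * by blast
      also have "D 0 \<omega> \<in> U 0 \<longleftrightarrow> X (T (Suc j)) \<omega> - X 0 \<omega> \<in> B"
        by (simp add: D_def U_def s_def)
      finally show "\<omega> \<in> ?L \<longleftrightarrow> \<omega> \<in> ?R" by simp
    qed
  qed
  finally have eq: "\<P>(\<omega> in M. X (T (Suc j)) \<omega> - X 0 \<omega> \<in> B \<and> (\<forall>i\<le>j. X (T i) \<omega> - X (T (Suc i)) \<omega> \<in> S i)) =
      (\<Prod>i<Suc (Suc j). prob (D i -` U i \<inter> space M))" .
  have [measurable]: "X (T i) \<in> borel_measurable M" for i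
    using T(1)[of i] by simp
  note [measurable] = S B
  have "(\<Prod>i<Suc (Suc j). prob (D i -` U i \<inter> space M)) = 
     prob (D 0 -` U 0 \<inter> space M) * (\<Prod>i\<le>j. prob (D (Suc i) -` U (Suc i) \<inter> space M))"
    by (subst prod.lessThan_Suc_shift) (simp add: lessThan_Suc_atMost)
  also have "(\<Prod>i\<le>j. prob (D (Suc i) -` U (Suc i) \<inter> space M)) = (\<Prod>i\<le>j. prob (D (Suc (j - i)) -` U (Suc (j - i)) \<inter> space M))"
    by (rule prod.reindex_bij_witness[of _ "\<lambda>i. j - i" "\<lambda>i. j - i"]) auto
  also have "\<dots> = (\<Prod>i\<le>j. \<P>(\<omega> in M. X (T i - T (Suc i)) \<omega> \<in> S i))"
  proof (intro prod.cong refl)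
    fix i assume i: "i \<in> {..j}"
    have "D (Suc (j - i)) -` U (Suc (j - i)) \<inter> space M = {\<omega>\<in>space M. X (T i) \<omega> - X (T (Suc i)) \<omega> \<in> S i}"
      using i by (auto simp: D_def U_def s_def Suc_diff_le)
    then show "prob (D (Suc (j - i)) -` U (Suc (j - i)) \<inter> space M) = \<P>(\<omega> in M. X (T i - T (Suc i)) \<omega> \<in> S i)"
      using prob_increment[of "T (Suc i)" "T i" "S i"] T(1)[of "Suc i"] T(2)[of i] S by simp
  qed
  also have "D 0 -` U 0 \<inter> space M = {\<omega>\<in>space M. X (T (Suc j)) \<omega> - X 0 \<omega> \<in> B}"
    by (auto simp: D_def U_def s_def)
  also have "prob \<dots> = \<P>(\<omega> in M. X (T (Suc j)) \<omega> \<in> B)"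
    using AE_X0 by (intro finite_measure_eq_AE) auto
  finally have "(\<Prod>i<Suc (Suc j). prob (D i -` U i \<inter> space M)) =
    \<P>(\<omega> in M. X (T (Suc j)) \<omega> \<in> B) * (\<Prod>i\<le>j. \<P>(\<omega> in M. X (T i - T (Suc i)) \<omega> \<in> S i))" .
  moreover have "\<P>(\<omega> in M. X (T (Suc j)) \<omega> - X 0 \<omega> \<in> B \<and> (\<forall>i\<le>j. X (T i) \<omega> - X (T (Suc i)) \<omega> \<in> S i)) =
    \<P>(\<omega> in M. X (T (Suc j)) \<omega> \<in> B \<and> (\<forall>i\<le>j. X (T i) \<omega> - X (T (Suc i)) \<omega> \<in> S i))"
    using AE_X0 by (intro finite_measure_eq_AE) auto
  ultimately show ?thesis using eq by simp
qed

end

section \<open>Rescaling, geometric intervals, and divergent series\<close>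

lemma norm_rescale_less:
  fixes x y z :: "'a::real_normed_vector"
  assumes "0 < \<beta>" "\<beta> \<le> B" "(1 - d) * B \<le> \<beta>" "d * norm x \<le> e"
    and y: "norm ((1 / \<beta>) *\<^sub>R y - x) < e" and z: "norm z \<le> e * B"
  shows "norm ((1 / B) *\<^sub>R (y + z) - x) < 3 * e"
proof -
  define r where "r = \<beta> / B"
  have B: "0 < B" using assms by simp
  have r: "0 \<le> r" "r \<le> 1" "1 - r \<le> d"
    using assms B by (auto simp: r_def field_simps)
  \<comment> \<open>The three terms are the original error shrunk by \<open>r\<close>, the
    perturbation, and the part of \<open>x\<close> lost by changing the normalisation. Each costs at
    most \<open>e\<close>, the first strictly less.\<close>
  have "(1 / B) *\<^sub>R (y + z) - x = r *\<^sub>R ((1 / \<beta>) *\<^sub>R y - x) + (1 / B) *\<^sub>R z - (1 - r) *\<^sub>R x"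
    using B \<open>0 < \<beta>\<close> by (simp add: r_def algebra_simps)
  also have "norm \<dots> \<le> norm (r *\<^sub>R ((1 / \<beta>) *\<^sub>R y - x)) + norm ((1 / B) *\<^sub>R z) + norm ((1 - r) *\<^sub>R x)"
    by (meson norm_triangle_ineq norm_triangle_ineq4 order_trans add_right_mono)
  also have "norm (r *\<^sub>R ((1 / \<beta>) *\<^sub>R y - x)) < e"
    using r y mult_right_mono[of r 1 "norm ((1 / \<beta>) *\<^sub>R y - x)"] by simp
  also have "norm ((1 / B) *\<^sub>R z) \<le> e" using z B by (simp add: field_simps)
  also have "norm ((1 - r) *\<^sub>R x) \<le> e"
    using r assms(4) mult_right_mono[of "1 - r" d "norm x"] by simp
  finally show ?thesis by simp
qed

text \<open>Half open, so that for \<open>0 < c < 1\<close> the intervals partition the times in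
  \<open>{0<..1}\<close>. All have the same mass under \<open>dt / t\<close>.\<close>

definition geo_ivl :: "real \<Rightarrow> nat \<Rightarrow> real set" where
  "geo_ivl c k = {c ^ Suc k <.. c ^ k}"

lemma geo_ivl_exists:
  assumes "0 < c" "c < 1" "0 < t" "t \<le> 1"
  shows "\<exists>k. t \<in> geo_ivl c k"
proof -
  obtain n where "c ^ n < t"
    using real_arch_pow_inv[OF \<open>0 < t\<close> \<open>c < 1\<close>] by auto
  then obtain k where "\<not> c ^ k < t" "c ^ Suc k < t"
    using ex_least_nat_less[of "\<lambda>k. c ^ k < t" n] \<open>t \<le> 1\<close> by (metis lessI not_less power_0 order_refl)
  then show ?thesis by (auto simp: geo_ivl_def)
qed

lemma disjoint_geo_ivl:
  assumes "0 < c" "c < 1"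
  shows "disjoint_family (geo_ivl c)"
proof -
  have "geo_ivl c i \<inter> geo_ivl c j = {}" if "i < j" for i j
  proof -
    have "c ^ j \<le> c ^ Suc i" by (rule power_decreasing) (use assms that in auto)
    then show ?thesis by (auto simp: geo_ivl_def)
  qed
  then show ?thesis unfolding disjoint_family_on_def by (metis Int_commute linorder_neqE_nat)
qed

lemma geo_ivl_bounds:
  assumes "0 < c" "c < 1" "t \<in> geo_ivl c k"
  shows "0 < t" "t \<le> 1" "c ^ Suc k < t" "t \<le> c ^ k"
proof -
  show *: "c ^ Suc k < t" "t \<le> c ^ k" using assms(3) by (auto simp: geo_ivl_def)
  show "0 < t" using *(1) assms by (smt (verit) zero_less_power)
  show "t \<le> 1" using *(2) assms power_le_one[of c k] by simp
qed

lemma sets_geo_ivl [measurable]: "geo_ivl c k \<in> sets borel"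
  by (simp add: geo_ivl_def)

text \<open>The bridge between integrals against \<open>dt / t\<close> and series: the weight
  \<open>1 / c ^ k\<close> cancels against the length \<open>(1 - c) * c ^ k\<close> of the
  interval.\<close>

lemma nn_integral_geo_steps:
  assumes c: "0 < c" "c < 1" and a: "\<And>k. 0 \<le> a k"
  shows "(\<integral>\<^sup>+t. (\<Sum>k. ennreal (a k / c ^ k) * indicator (geo_ivl c k) t) \<partial>lborel)
    = (\<Sum>k. ennreal ((1 - c) * a k))"
proof -
  have "(\<integral>\<^sup>+t. (\<Sum>k. ennreal (a k / c ^ k) * indicator (geo_ivl c k) t) \<partial>lborel) =
    (\<Sum>k. \<integral>\<^sup>+t. ennreal (a k / c ^ k) * indicator (geo_ivl c k) t \<partial>lborel)"
    by (rule nn_integral_suminf) measurable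
  also have "\<dots> = (\<Sum>k. ennreal ((1 - c) * a k))"
  proof (intro suminf_cong)
    fix k
    have "c ^ Suc k \<le> c ^ k" using c by (intro power_decreasing) auto
    then have "(\<integral>\<^sup>+t. ennreal (a k / c ^ k) * indicator (geo_ivl c k) t \<partial>lborel) = ennreal (a k / c ^ k) * ennreal (c ^ k - c ^ Suc k)"
      by (subst nn_integral_cmult_indicator) (auto simp: geo_ivl_def)
    also have "\<dots> = ennreal (a k / c ^ k * (c ^ k - c ^ Suc k))"
      using a c by (intro ennreal_mult'[symmetric]) simp
    also have "a k / c ^ k * (c ^ k - c ^ Suc k) = (1 - c) * a k"
      using c by (simp add: field_simps)
    finally show "(\<integral>\<^sup>+t. ennreal (a k / c ^ k) * indicator (geo_ivl c k) t \<partial>lborel) = ennreal ((1 - c) * a k)" .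
  qed
  finally show ?thesis .
qed

lemma suminf_geo_ivl_eq:
  assumes "0 < c" "c < 1" "t \<in> geo_ivl c k"
  shows "(\<Sum>n. f n * indicator (geo_ivl c n) t) = (f k :: ennreal)"
  by (rule suminf_cmult_indicator[OF disjoint_geo_ivl]) (use assms in auto)

lemma suminf_geo_ivl_eq_0:
  assumes "0 < c" "c < 1" "t \<notin> {0<..1}"
  shows "(\<Sum>n. f n * indicator (geo_ivl c n) t) = (0 :: ennreal)"
proof -
  have "indicator (geo_ivl c n) t = (0::ennreal)" for n
    using geo_ivl_bounds[OF assms(1,2), of t n] assms(3) by (auto simp: indicator_def)
  then show ?thesis by simp
qed

text \<open>The supremum need not be attained, so a factor \<open>2\<close> is paid for a genuine
  point of \<open>I\<close>; if \<open>f\<close> vanishes on \<open>I\<close>, any point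
  serves.\<close>

lemma ex_half_sup:
  fixes f :: "'a \<Rightarrow> real"
  assumes "u0 \<in> I" "\<And>t. 0 \<le> f t" "\<And>t. f t \<le> 1"
  shows "\<exists>u\<in>I. \<forall>t\<in>I. f t \<le> 2 * f u"
proof (cases "\<exists>u\<in>I. 0 < f u")
  case False
  then show ?thesis using assms by (smt (verit))
next
  case True
  then obtain u1 where u1: "u1 \<in> I" "0 < f u1" by auto
  have bdd: "bdd_above (f ` I)" using assms(3) by (auto intro!: bdd_aboveI[where M=1])
  have "0 < Sup (f ` I)" using u1 cSUP_upper[OF u1(1) bdd] by simp
  then have "Sup (f ` I) / 2 < Sup (f ` I)" by simp
  then obtain u where "u \<in> I" "Sup (f ` I) / 2 < f u"
    using less_cSUP_iff[OF _ bdd, of "Sup (f ` I) / 2"] u1(1) by blast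
  then show ?thesis using cSUP_upper[OF _ bdd] by (intro bexI[of _ u]) force+
qed

text \<open>Used in contrapositive form: a divergent series still diverges along the even or along
  the odd indices.\<close>

lemma summable_even_odd:
  fixes a :: "nat \<Rightarrow> real"
  assumes "summable (\<lambda>k. a (2 * k))" "summable (\<lambda>k. a (2 * k + 1))"
  shows "summable a"
proof -
  have "(\<lambda>n. if even n then a (2 * (n div 2)) else a (2 * ((n - 1) div 2) + 1)) sums
    (suminf (\<lambda>k. a (2 * k + 1)) + suminf (\<lambda>k. a (2 * k)))"
    by (rule sums_if[OF summable_sums[OF assms(2)] summable_sums[OF assms(1)]])
  also have "(\<lambda>n. if even n then a (2 * (n div 2)) else a (2 * ((n - 1) div 2) + 1)) = a"
    by (auto simp: fun_eq_iff elim!: oddE)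
  finally show ?thesis by (rule sums_summable)
qed

text \<open>Near-maximisers of \<open>f\<close> on the geometric intervals give a divergent series,
  since otherwise a step function with finite integral would dominate the integrand. Maximisers in
  adjacent intervals can be arbitrarily close, so only intervals of one parity are kept; dropping
  finitely many terms then brings \<open>v 0\<close> below \<open>z\<close>.\<close>

lemma ex_geometric_not_summable:
  fixes f :: "real \<Rightarrow> real"
  assumes f: "\<And>t. 0 \<le> f t" "\<And>t. f t \<le> 1" and c: "0 < c" "c < 1" and "0 < z"
    and inf: "(\<integral>\<^sup>+ t. indicator {0<..1} t * ennreal (f t / t) \<partial>lborel) = \<infinity>"
  shows "\<exists>v. v 0 \<le> z \<and> (\<forall>k. 0 < v k \<and> v (Suc k) \<le> c * v k) \<and> \<not> summable (\<lambda>k::nat. f (v k))"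
proof -
  have "\<exists>u\<in>geo_ivl c k. \<forall>t\<in>geo_ivl c k. f t \<le> 2 * f u" for k
    by (rule ex_half_sup[of "c ^ k"]) (use f c in \<open>auto simp: geo_ivl_def\<close>)
  then obtain u where u: "\<And>k. u k \<in> geo_ivl c k" "\<And>k t. t \<in> geo_ivl c k \<Longrightarrow> f t \<le> 2 * f (u k)"
    by metis
  note ub = geo_ivl_bounds[OF c u(1)]
  have ns: "\<not> summable (\<lambda>k. f (u k))"
  proof
    assume sm: "summable (\<lambda>k. f (u k))"
    \<comment> \<open>The \<open>2\<close> comes from the half-supremum, the \<open>1 / c\<close>
      from bounding \<open>1 / t\<close> by \<open>1 / c ^ Suc k\<close> while the steps are
      normalised by \<open>c ^ k\<close>.\<close>
    define a where "a k = 2 / c * f (u k)" for k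
    have "(\<integral>\<^sup>+ t. indicator {0<..1} t * ennreal (f t / t) \<partial>lborel) \<le>
      (\<integral>\<^sup>+t. (\<Sum>k. ennreal (a k / c ^ k) * indicator (geo_ivl c k) t) \<partial>lborel)"
    proof (rule nn_integral_mono)
      fix t
      show "indicator {0<..1} t * ennreal (f t / t) \<le> (\<Sum>k. ennreal (a k / c ^ k) * indicator (geo_ivl c k) t)"
      proof (cases "t \<in> {0<..1}")
        case True
        then obtain k where k: "t \<in> geo_ivl c k" using geo_ivl_exists[OF c, of t] by auto
        note tb = geo_ivl_bounds[OF c k]
        have "f t / t \<le> 2 * f (u k) / c ^ Suc k"
          using u(2)[OF k] tb c f by (intro frac_le) auto
        also have "\<dots> = a k / c ^ k" by (simp add: a_def)
        finally show ?thesis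
          unfolding suminf_geo_ivl_eq[OF c k] using True by (simp add: ennreal_leI)
      qed simp
    qed
    also have "\<dots> = (\<Sum>k. ennreal ((1 - c) * a k))"
      by (rule nn_integral_geo_steps[OF c]) (use f c in \<open>simp add: a_def\<close>)
    also have "\<dots> = ennreal (\<Sum>k. (1 - c) * a k)"
      by (rule suminf_ennreal2) (use f c sm in \<open>auto simp: a_def intro!: summable_mult\<close>)
    finally show False using inf by (simp add: top_unique)
  qed
  then obtain w where w: "\<not> summable (\<lambda>k. f (w k))" "\<And>k. 0 < w k" "\<And>k. w (Suc k) \<le> c * w k" "\<And>k. w k \<le> c ^ k"
  proof -
    \<comment> \<open>Skipping a whole interval forces the ratio: \<open>c ^ Suc (Suc k)\<close> is
      \<open>c\<close> times the lower end of interval \<open>k\<close>.\<close>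
    have *: "u (Suc (Suc k)) \<le> c * u k" for k
      using ub(4)[of "Suc (Suc k)"] ub(3)[of k] c(1) by (metis less_imp_le mult_left_mono order_trans power_Suc)
    have **: "u (2 * k) \<le> c ^ k" "u (2 * k + 1) \<le> c ^ k" for k
      by (rule order_trans[OF ub(4) power_decreasing]; use c in simp)+
    consider "\<not> summable (\<lambda>k. f (u (2 * k)))" | "\<not> summable (\<lambda>k. f (u (2 * k + 1)))"
      using ns summable_even_odd[of "\<lambda>k. f (u k)"] by blast
    then show thesis
    proof cases
      case 1
      show thesis by (rule that[of "\<lambda>k. u (2 * k)"]) (use 1 ub(1) *[of "2 * k" for k] ** in auto)
    next
      case 2
      show thesis by (rule that[of "\<lambda>k. u (2 * k + 1)"]) (use 2 ub(1) *[of "2 * k + 1" for k] ** in auto)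
    qed
  qed
  obtain k0 where k0: "c ^ k0 < z" using real_arch_pow_inv[OF \<open>0 < z\<close> \<open>c < 1\<close>] by auto
  have "\<not> summable (\<lambda>k. f (w (k + k0)))"
    using w(1) summable_iff_shift[of "\<lambda>k. f (w k)" k0] by simp
  then show ?thesis
    using w(2,3) w(4)[of k0] k0 by (intro exI[of _ "\<lambda>k. w (k + k0)"]) auto
qed

text \<open>Comparison with a geometric series of ratio at most \<open>1/2\<close> shows that each
  tail is at most twice its first term.\<close>

lemma geometric_tails:
  fixes v :: "nat \<Rightarrow> real"
  assumes c: "0 < c" "c \<le> 1/2" and v: "\<And>k. 0 < v k" "\<And>k. v (Suc k) \<le> c * v k"
  defines "T \<equiv> \<lambda>k. \<Sum>j. v (k + j)"
  shows "T k = v k + T (Suc k)" "0 < T k" "T (Suc k) \<le> 2 * c * v k" "T k \<le> 2 * v 0"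
proof -
  have geo: "v (k + j) \<le> c ^ j * v k" for k j
  proof (induction j)
    case (Suc j)
    have "v (k + Suc j) \<le> c * v (k + j)" using v(2)[of "k + j"] by simp
    also have "\<dots> \<le> c * (c ^ j * v k)" using c Suc by (intro mult_left_mono) auto
    finally show ?case by (simp add: mult_ac)
  qed simp
  have sg: "summable (\<lambda>j. c ^ j * v k)" for k
    using c by (intro summable_mult2 summable_geometric) auto
  have sm: "summable (\<lambda>j. v (k + j))" for k
    by (rule summable_comparison_test'[OF sg[of k], of 0]) (use geo v(1) less_imp_le in \<open>auto simp: abs_of_pos\<close>)
  have pos: "0 < T k" for k
    unfolding T_def using sm v(1) by (intro suminf_pos) auto
  show "0 < T k" by (rule pos)
  have split: "T k = v k + T (Suc k)" for k
    unfolding T_def using suminf_split_head[OF sm[of k]] by simp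
  show "T k = v k + T (Suc k)" by (rule split)
  have le: "T k \<le> 2 * v k" for k
  proof -
    have "T k \<le> (\<Sum>j. c ^ j * v k)"
      unfolding T_def by (intro suminf_le geo sm sg)
    also have "\<dots> = v k / (1 - c)"
      using c by (subst suminf_mult2[symmetric]) (auto simp: suminf_geometric intro!: summable_geometric)
    also have "\<dots> \<le> v k / (1/2)" using c v(1)[of k] by (intro divide_left_mono) auto
    finally show ?thesis by simp
  qed
  show "T (Suc k) \<le> 2 * c * v k" using le[of "Suc k"] v(2)[of k] by simp
  have "c ^ k * v 0 \<le> 1 * v 0" using c v(1)[of 0] by (intro mult_right_mono power_le_one) auto
  then have "v k \<le> v 0" using geo[of 0 k] by simp
  then show "T k \<le> 2 * v 0" using le[of k] by simp
qed

text \<open>For independent trials with success probabilities \<open>a i\<close>, the summand is the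
  probability that the first success is trial \<open>j\<close>, and the right side that of some
  success among the first \<open>N\<close>.\<close>

lemma sum_first_success:
  fixes a :: "nat \<Rightarrow> 'a::comm_ring_1"
  shows "(\<Sum>j<N. (\<Prod>i<j. 1 - a i) * a j) = 1 - (\<Prod>i<N. 1 - a i)"
  by (induction N) (auto simp: algebra_simps)

text \<open>The analytic core of the second Borel-Cantelli lemma:
  \<open>1 - a i \<le> exp (- a i)\<close> turns a product bounded away from \<open>0\<close> into
  bounded partial sums.\<close>

lemma prod_one_minus_small:
  fixes a :: "nat \<Rightarrow> real"
  assumes a: "\<And>i. 0 \<le> a i" "\<And>i. a i \<le> 1" and ns: "\<not> summable a" and "0 < d"
  shows "\<exists>N. (\<Prod>i<N. 1 - a i) \<le> d"
proof (rule ccontr)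
  assume "\<not> ?thesis"
  then have *: "d < (\<Prod>i<N. 1 - a i)" for N by (simp add: not_le)
  have "(\<Sum>i<N. a i) \<le> - ln d" for N
  proof -
    have "(\<Prod>i<N. 1 - a i) \<le> (\<Prod>i<N. exp (- a i))"
      using a exp_ge_add_one_self[of "- a i" for i] by (intro prod_mono) auto
    also have "\<dots> = exp (- (\<Sum>i<N. a i))" by (simp add: exp_sum sum_negf[symmetric])
    finally have "d < exp (- (\<Sum>i<N. a i))" using *[of N] by simp
    then have "ln d < - (\<Sum>i<N. a i)" using \<open>0 < d\<close> by (metis ln_exp ln_less_cancel_iff exp_gt_zero)
    then show ?thesis by simp
  qed
  then have "summable a" by (intro summableI_nonneg_bounded[of _ "- ln d"]) (use a in auto)
  then show False using ns by simp
qed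

section \<open>The normalised process over short times\<close>

definition hit_set :: "(real \<Rightarrow> real) \<Rightarrow> 'b::real_normed_vector \<Rightarrow> real \<Rightarrow> real \<Rightarrow> 'b set" where
  "hit_set b x e t = {y. norm ((1 / b t) *\<^sub>R y - x) < e}"

lemma sets_hit_set [measurable]:
  fixes x :: "'b::euclidean_space"
  shows "hit_set b x e t \<in> sets borel"
proof -
  have "open (hit_set b x e t)"
    unfolding hit_set_def by (intro open_Collect_less continuous_intros)
  then show ?thesis by simp
qed

text \<open>The growth conditions on \<open>b\<close> enter through two consequences:
  \<open>b_small\<close> makes \<open>b h\<close> negligible against \<open>b t\<close> when
  \<open>h / t\<close> is small, and \<open>b_near\<close> keeps \<open>b s\<close> close to
  \<open>b t\<close> when \<open>s / t\<close> is near \<open>1\<close>.\<close>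

locale normalized_levy = levy M X
  for M :: "'a measure" and X :: "real \<Rightarrow> 'a \<Rightarrow> 'b::euclidean_space" +
  fixes b :: "real \<Rightarrow> real" and x :: 'b
  assumes b_pos: "\<And>t. 0 < t \<Longrightarrow> t \<le> 1 \<Longrightarrow> 0 < b t"
    and b_mono: "\<And>s t. 0 < s \<Longrightarrow> s \<le> t \<Longrightarrow> t \<le> 1 \<Longrightarrow> b s \<le> b t"
    and b_cont: "\<And>t. 0 < t \<Longrightarrow> t < 1 \<Longrightarrow> isCont b t"
    and b_small: "\<And>K e. 0 < K \<Longrightarrow> 0 < e \<Longrightarrow> \<exists>c>0. \<exists>\<eta>>0. \<eta> \<le> 1 \<and>
        (\<forall>h t. 0 < h \<longrightarrow> h \<le> c * t \<longrightarrow> t \<le> \<eta> \<longrightarrow> K * b h \<le> e * b t)"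
    and b_near: "\<And>e. 0 < e \<Longrightarrow> \<exists>c>0. \<exists>\<eta>>0. \<eta> \<le> 1 \<and>
        (\<forall>s t. (1 - c) * t \<le> s \<longrightarrow> 0 < s \<longrightarrow> s \<le> t \<longrightarrow> t \<le> \<eta> \<longrightarrow> (1 - e) * b t \<le> b s)"
    and tight: "\<And>d. 0 < d \<Longrightarrow> \<exists>K>0. \<exists>\<eta>>0. \<forall>t. 0 < t \<longrightarrow> t < \<eta> \<longrightarrow>
        \<P>(\<omega> in M. K * b t < norm (X t \<omega>)) < d"
begin

abbreviation near :: "real \<Rightarrow> real \<Rightarrow> 'b set" where
  "near \<equiv> hit_set b x"

text \<open>One pair of constants serves both halves of the theorem. Tightness gives
  \<open>X h\<close> the order of \<open>b h\<close>, which \<open>b_small\<close> makes negligible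
  against \<open>b t\<close>; \<open>b_near\<close> controls the change of normalisation from
  \<open>s\<close> to \<open>t\<close>.\<close>

lemma small_time_constants:
  assumes "0 < e" "0 < d" "0 < z"
  shows "\<exists>c \<eta>. 0 < c \<and> c \<le> 1/2 \<and> 0 < \<eta> \<and> \<eta> \<le> 1 \<and> \<eta> \<le> z \<and>
    (\<forall>h t. 0 < h \<longrightarrow> h \<le> c * t \<longrightarrow> t \<le> \<eta> \<longrightarrow> 1 - d \<le> \<P>(\<omega> in M. norm (X h \<omega>) \<le> e * b t)) \<and>
    (\<forall>s t y w. (1 - c) * t \<le> s \<longrightarrow> 0 < s \<longrightarrow> s \<le> t \<longrightarrow> t \<le> \<eta> \<longrightarrow>
       y \<in> near e s \<longrightarrow> norm w \<le> e * b t \<longrightarrow> y + w \<in> near (3 * e) t)"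
proof -
  obtain K \<eta>1 where K: "0 < K" "0 < \<eta>1"
    "\<And>t. 0 < t \<Longrightarrow> t < \<eta>1 \<Longrightarrow> \<P>(\<omega> in M. K * b t < norm (X t \<omega>)) < d"
    using tight[OF \<open>0 < d\<close>] by blast
  obtain c2 \<eta>2 where 2: "0 < c2" "0 < \<eta>2" "\<eta>2 \<le> 1"
    "\<And>h t. 0 < h \<Longrightarrow> h \<le> c2 * t \<Longrightarrow> t \<le> \<eta>2 \<Longrightarrow> K * b h \<le> e * b t"
    using b_small[OF \<open>0 < K\<close> \<open>0 < e\<close>] by blast
  \<comment> \<open>The added \<open>1\<close> covers \<open>x = 0\<close> while still giving
    \<open>f * norm x \<le> e\<close>.\<close>
  define f where "f = e / (norm x + 1)"
  have nx: "0 < norm x + 1" by (smt (verit) norm_ge_zero)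
  have f: "0 < f" "f * norm x \<le> e"
    using \<open>0 < e\<close> nx by (auto simp: f_def field_simps)
  obtain c3 \<eta>3 where 3: "0 < c3" "0 < \<eta>3" "\<eta>3 \<le> 1"
    "\<And>s t. (1 - c3) * t \<le> s \<Longrightarrow> 0 < s \<Longrightarrow> s \<le> t \<Longrightarrow> t \<le> \<eta>3 \<Longrightarrow> (1 - f) * b t \<le> b s"
    using b_near[OF f(1)] by blast
  \<comment> \<open>The bound \<open>1/2\<close> puts \<open>h\<close> strictly below
    \<open>t\<close>, hence strictly below \<open>\<eta>1\<close>, as the tightness estimate
    requires.\<close>
  define c where "c = min (1/2) (min c2 c3)"
  define \<eta> where "\<eta> = min (min z \<eta>1) (min \<eta>2 \<eta>3)"
  have "1 - d \<le> \<P>(\<omega> in M. norm (X h \<omega>) \<le> e * b t)" if "0 < h" "h \<le> c * t" "t \<le> \<eta>" for h t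
  proof -
    have "0 < t" using that 2(1) 3(1) by (smt (verit) c_def mult_nonneg_nonpos zero_less_divide_1_iff)
    have "c * t \<le> c2 * t" "c * t \<le> 1/2 * t"
      using \<open>0 < t\<close> by (auto simp: c_def intro!: mult_right_mono)
    then have h: "h \<le> c2 * t" "h < \<eta>1" "t \<le> \<eta>2"
      using that \<open>0 < t\<close> unfolding \<eta>_def by linarith+
    have [measurable]: "X h \<in> borel_measurable M" using \<open>0 < h\<close> by simp
    have "1 - d \<le> 1 - \<P>(\<omega> in M. K * b h < norm (X h \<omega>))"
      using K(3)[OF \<open>0 < h\<close> h(2)] by simp
    also have "\<dots> = \<P>(\<omega> in M. \<not> K * b h < norm (X h \<omega>))"
      by (rule prob_neg[symmetric]) measurable
    also have "\<dots> \<le> \<P>(\<omega> in M. norm (X h \<omega>) \<le> e * b t)"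
      using 2(4)[OF \<open>0 < h\<close> h(1,3)] by (intro finite_measure_mono) auto
    finally show ?thesis .
  qed
  moreover have "y + w \<in> near (3 * e) t"
    if "(1 - c) * t \<le> s" "0 < s" "s \<le> t" "t \<le> \<eta>" "y \<in> near e s" "norm w \<le> e * b t" for s t y w
  proof -
    have "(1 - c3) * t \<le> (1 - c) * t"
      using that by (intro mult_right_mono) (auto simp: c_def)
    then have "(1 - c3) * t \<le> s" using that(1) by (rule order_trans)
    then have near: "(1 - f) * b t \<le> b s"
      using that by (intro 3(4)) (auto simp: \<eta>_def)
    have t1: "t \<le> 1" using that(4) 2(3) by (simp add: \<eta>_def)
    show ?thesis
      using norm_rescale_less[OF b_pos b_mono near f(2), of y w] that t1
      by (auto simp: hit_set_def)
  qed
  moreover have "0 < c" "c \<le> 1/2" "0 < \<eta>" "\<eta> \<le> 1" "\<eta> \<le> z"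
    using K 2 3 \<open>0 < z\<close> by (auto simp: c_def \<eta>_def)
  ultimately show ?thesis by blast
qed

section \<open>Finite integral: almost surely no clustering at \<open>x\<close>\<close>

lemma prob_hit_finite_le:
  assumes "0 < e"
  shows "\<exists>r \<eta>. 0 < r \<and> r < 1 \<and> 0 < \<eta> \<and> \<eta> \<le> 1 \<and>
    (\<forall>w F. 0 < w \<longrightarrow> w \<le> \<eta> \<longrightarrow> finite F \<longrightarrow> F \<subseteq> {r * w..<w} \<longrightarrow>
      \<P>(\<omega> in M. \<exists>t\<in>F. X t \<omega> \<in> near e t) \<le> 2 * \<P>(\<omega> in M. X w \<omega> \<in> near (3 * e) w))"
proof -
  obtain c \<eta> where c: "0 < c" "c \<le> 1/2" "0 < \<eta>" "\<eta> \<le> 1"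
    and P: "\<And>h t. 0 < h \<Longrightarrow> h \<le> c * t \<Longrightarrow> t \<le> \<eta> \<Longrightarrow> 1 - 1/2 \<le> \<P>(\<omega> in M. norm (X h \<omega>) \<le> e * b t)"
    and N: "\<And>s t y w. (1 - c) * t \<le> s \<Longrightarrow> 0 < s \<Longrightarrow> s \<le> t \<Longrightarrow> t \<le> \<eta> \<Longrightarrow>
       y \<in> near e s \<Longrightarrow> norm w \<le> e * b t \<Longrightarrow> y + w \<in> near (3 * e) t"
    using small_time_constants[OF \<open>0 < e\<close>, of "1/2" 1] by auto
  have "\<P>(\<omega> in M. \<exists>t\<in>F. X t \<omega> \<in> near e t) \<le> 2 * \<P>(\<omega> in M. X w \<omega> \<in> near (3 * e) w)"
    if w: "0 < w" "w \<le> \<eta>" and F: "finite F" "F \<subseteq> {(1 - c) * w..<w}" for w F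
  proof -
    \<comment> \<open>Disjoint first-hit events stand in for the strong Markov property.\<close>
    define G where "G t = {s\<in>F. s \<le> t}" for t
    define Q where "Q t s = (if s = t then near e t else - near e s)" for t s
    define first where "first t = {\<omega>\<in>space M. \<forall>s\<in>G t. X s \<omega> \<in> Q t s}" for t
    define J where "J t = {\<omega>\<in>space M. (\<forall>s\<in>G t. X s \<omega> \<in> Q t s) \<and> X w \<omega> - X t \<omega> \<in> cball 0 (e * b w)}" for t
    have tpos: "0 < t" if "t \<in> F" for t
    proof -
      have "0 < (1 - c) * w" using w c by (intro mult_pos_pos) auto
      then show ?thesis using F(2) that by (auto intro: less_le_trans)
    qed
    have [measurable]: "X w \<in> borel_measurable M" using w by simp
    have [measurable]: "Q t s \<in> sets borel" for t s by (simp add: Q_def)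
    have Xm: "X t \<in> borel_measurable M" if "t \<in> F" for t using tpos[OF that] by simp
    have firstm: "first t \<in> sets M" for t
      unfolding first_def G_def
      by (intro sets.sets_Collect_finite_All predE)
       (use F Xm in \<open>auto intro!: pred_sets1\<close>)
    have Jm: "J t \<in> sets M" if "t \<in> F" for t
    proof -
      note [measurable] = Xm[OF that]
      have "J t = first t \<inter> {\<omega>\<in>space M. X w \<omega> - X t \<omega> \<in> cball 0 (e * b w)}"
        by (auto simp: J_def first_def)
      also have "\<dots> \<in> sets M"
      proof (rule sets.Int[OF firstm])
        have W: "{\<omega>\<in>space M. X w \<omega> - X t \<omega> \<in> W} \<in> sets M" if [measurable]: "W \<in> sets borel" for W
          by measurable
        show "{\<omega>\<in>space M. X w \<omega> - X t \<omega> \<in> cball 0 (e * b w)} \<in> sets M"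
          by (rule W) simp
      qed
      finally show ?thesis .
    qed
    \<comment> \<open>After a first hit at \<open>t\<close>, the increment up to \<open>w\<close> is
      independent of the past and small with probability at least \<open>1/2\<close>; this is the
      source of the factor \<open>2\<close>.\<close>
    have half: "prob (first t) \<le> 2 * prob (J t)" if t: "t \<in> F" for t
    proof -
      have tw: "t < w" "(1 - c) * w \<le> t" using F(2) t by auto
      have "prob (J t) = prob (first t) * \<P>(\<omega> in M. X (w - t) \<omega> \<in> cball 0 (e * b w))"
        unfolding J_def first_def
        by (rule prob_past_increment) (use F t tpos tw in \<open>auto simp: G_def\<close>)
      moreover have "1/2 \<le> \<P>(\<omega> in M. X (w - t) \<omega> \<in> cball 0 (e * b w))"
        using P[of "w - t" w] tw w by (simp add: algebra_simps)
      ultimately show ?thesis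
        using mult_left_mono[of "1/2" "\<P>(\<omega> in M. X (w - t) \<omega> \<in> cball 0 (e * b w))" "prob (first t)"] by simp
    qed
    have "{\<omega>\<in>space M. \<exists>t\<in>F. X t \<omega> \<in> near e t} \<subseteq> (\<Union>t\<in>F. first t)"
    proof safe
      fix \<omega> t assume \<omega>: "\<omega> \<in> space M" "t \<in> F" "X t \<omega> \<in> near e t"
      define t' where "t' = Min {t\<in>F. X t \<omega> \<in> near e t}"
      have "t' \<in> {t\<in>F. X t \<omega> \<in> near e t}" unfolding t'_def by (rule Min_in) (use F \<omega> in auto)
      moreover have "t' \<le> s" if "s \<in> F" "X s \<omega> \<in> near e s" for s
        unfolding t'_def by (rule Min_le) (use F that in auto)
      ultimately show "\<omega> \<in> (\<Union>t\<in>F. first t)"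
        using \<omega>(1) by (intro UN_I[of t']) (force simp: first_def G_def Q_def)+
    qed
    then have "\<P>(\<omega> in M. \<exists>t\<in>F. X t \<omega> \<in> near e t) \<le> prob (\<Union>t\<in>F. first t)"
      using F firstm by (intro finite_measure_mono) auto
    also have "\<dots> \<le> (\<Sum>t\<in>F. prob (first t))"
      using F firstm by (intro finite_measure_subadditive_finite) auto
    also have "\<dots> \<le> (\<Sum>t\<in>F. 2 * prob (J t))" by (intro sum_mono half)
    \<comment> \<open>Disjointness recombines the sum into a single probability, so the bound does
      not depend on the size of \<open>F\<close>.\<close>
    also have "\<dots> = 2 * prob (\<Union>t\<in>F. J t)"
    proof -
      have "J s \<inter> J t = {}" if "s \<in> F" "t \<in> F" "s < t" for s t
        using that by (force simp: J_def G_def Q_def)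
      then have "disjoint_family_on J F"
        unfolding disjoint_family_on_def by (metis Int_commute linorder_neqE_linordered_idom)
      then show ?thesis
        using F Jm by (subst finite_measure_finite_Union) (auto simp: sum_distrib_left)
    qed
    also have "prob (\<Union>t\<in>F. J t) \<le> \<P>(\<omega> in M. X w \<omega> \<in> near (3 * e) w)"
    proof (intro finite_measure_mono subsetI)
      fix \<omega> assume "\<omega> \<in> (\<Union>t\<in>F. J t)"
      then obtain t where t: "t \<in> F" "\<omega> \<in> space M" "X t \<omega> \<in> near e t" "norm (X w \<omega> - X t \<omega>) \<le> e * b w"
        by (auto simp: J_def G_def Q_def split: if_splits)
      have "X t \<omega> + (X w \<omega> - X t \<omega>) \<in> near (3 * e) w"
        by (rule N[of w t]) (use t F(2) tpos[OF t(1)] w in auto)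
      then show "\<omega> \<in> {\<omega>\<in>space M. X w \<omega> \<in> near (3 * e) w}" using t by simp
    qed measurable
    finally show ?thesis by simp
  qed
  then show ?thesis
    using c by (intro exI[of _ "1 - c"] exI[of _ \<eta>]) auto
qed

text \<open>Continuity from below along an enumeration of \<open>C\<close> carries the bound from
  finite to countable sets of times.\<close>

lemma prob_hit_countable_le:
  assumes le: "\<And>F. finite F \<Longrightarrow> F \<subseteq> C \<Longrightarrow> \<P>(\<omega> in M. \<exists>t\<in>F. X t \<omega> \<in> near e t) \<le> p"
    and C: "countable C" "\<And>t. t \<in> C \<Longrightarrow> 0 \<le> t"
  shows "\<P>(\<omega> in M. \<exists>t\<in>C. X t \<omega> \<in> near e t) \<le> p"
proof (cases "C = {}")
  case True
  then show ?thesis using le[of "{}"] by simp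
next
  case False
  define u where "u = from_nat_into C"
  have u: "range u = C" using C False by (simp add: u_def range_from_nat_into)
  have [measurable]: "X (u n) \<in> borel_measurable M" for n
    using C(2)[of "u n"] u by auto
  define A where "A n = {\<omega>\<in>space M. \<exists>t\<in>u ` {..<n}. X t \<omega> \<in> near e t}" for n
  have A: "A n \<in> sets M" for n
  proof -
    have "A n = {\<omega>\<in>space M. \<exists>k<n. X (u k) \<omega> \<in> near e (u k)}" by (auto simp: A_def)
    then show ?thesis by simp
  qed
  have "incseq A" unfolding A_def incseq_def by fastforce
  then have "(\<lambda>n. prob (A n)) \<longlonglongrightarrow> prob (\<Union>n. A n)"
    using A by (intro finite_Lim_measure_incseq) auto
  moreover have "prob (A n) \<le> p" for n
    unfolding A_def using u by (intro le) auto
  ultimately have "prob (\<Union>n. A n) \<le> p" by (intro LIMSEQ_le_const2) auto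
  also have "(\<Union>n. A n) = {\<omega>\<in>space M. \<exists>t\<in>C. X t \<omega> \<in> near e t}"
    unfolding u[symmetric] A_def by (auto 4 4)
  finally show ?thesis .
qed

abbreviation hit_prob :: "real \<Rightarrow> real \<Rightarrow> real" where
  "hit_prob e t \<equiv> \<P>(\<omega> in M. X t \<omega> \<in> near e t)"

text \<open>For large \<open>k\<close>, the hit probability in interval \<open>Suc k\<close> is
  controlled at every \<open>w\<close> of interval \<open>k\<close>, so a step function built from
  these probabilities lies below the integrand and they are summable. Right continuity of the paths
  reduces hits at arbitrary times to hits in the countable sets \<open>C k\<close>.\<close>

lemma AE_not_cluster:
  assumes "0 < e"
    and fin: "(\<integral>\<^sup>+ t. indicator {0<..1} t * ennreal (hit_prob (3 * e) t / t) \<partial>lborel) \<noteq> \<infinity>"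
  shows "AE \<omega> in M. x \<notin> cluster_set_at0 (\<lambda>t. (1 / b t) *\<^sub>R X t \<omega>)"
proof -
  obtain r \<eta> where r: "0 < r" "r < 1" and \<eta>: "0 < \<eta>" "\<eta> \<le> 1"
    and hit: "\<And>w F. 0 < w \<Longrightarrow> w \<le> \<eta> \<Longrightarrow> finite F \<Longrightarrow> F \<subseteq> {r * w..<w} \<Longrightarrow>
      \<P>(\<omega> in M. \<exists>t\<in>F. X t \<omega> \<in> near e t) \<le> 2 * hit_prob (3 * e) w"
    using prob_hit_finite_le[OF \<open>0 < e\<close>] by blast
  \<comment> \<open>Points of adjacent intervals differ by a ratio above \<open>c * c\<close>, so
    the square root places interval \<open>Suc k\<close> inside \<open>{r * w..<w}\<close> for each
    \<open>w\<close> of interval \<open>k\<close>.\<close>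
  define c where "c = sqrt r"
  have c: "0 < c" "c < 1" and c2: "c * c = r" using r by (auto simp: c_def)
  \<comment> \<open>The right endpoint is added separately: it may be irrational, and approaching it
    from the right would leave the interval.\<close>
  define C where "C k = insert (c ^ k) (\<rat> \<inter> geo_ivl c k)" for k
  have C_sub: "C k \<subseteq> geo_ivl c k" for k
    using c by (auto simp: C_def geo_ivl_def)
  define H where "H k = {\<omega>\<in>space M. \<exists>t\<in>C k. X t \<omega> \<in> near e t}" for k
  have countC: "countable (C k)" for k by (auto simp: C_def intro: countable_Int1 countable_rat)
  have C_ge0: "t \<in> C k \<Longrightarrow> 0 \<le> t" for t k
    using geo_ivl_bounds(1)[OF c] C_sub[of k] by (meson less_imp_le subsetD)
  have Hm: "H k \<in> sets M" for k
  proof -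
    have "H k = (\<Union>t\<in>C k. {\<omega>\<in>space M. X t \<omega> \<in> near e t})" by (auto simp: H_def)
    also have "\<dots> \<in> sets M"
    proof (rule sets.countable_UN''[OF countC])
      fix t assume "t \<in> C k"
      then have [measurable]: "X t \<in> borel_measurable M" using C_ge0 by simp
      show "{\<omega> \<in> space M. X t \<omega> \<in> near e t} \<in> sets M" by measurable
    qed
    finally show ?thesis .
  qed
  obtain k0 where k0: "c ^ k0 < \<eta>" using real_arch_pow_inv[OF \<open>0 < \<eta>\<close> \<open>c < 1\<close>] by auto
  have le: "prob (H (Suc k)) \<le> 2 * hit_prob (3 * e) w" if "k0 \<le> k" "w \<in> geo_ivl c k" for k w
    unfolding H_def
  proof (rule prob_hit_countable_le[OF _ countC C_ge0])
    fix F assume F: "finite F" "F \<subseteq> C (Suc k)"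
    note wb = geo_ivl_bounds[OF c that(2)]
    have "c ^ k \<le> c ^ k0" using c that by (intro power_decreasing) auto
    moreover have "F \<subseteq> {r * w..<w}"
    proof
      fix t assume "t \<in> F"
      then have "t \<in> geo_ivl c (Suc k)" using F C_sub by blast
      note tb = geo_ivl_bounds[OF c this]
      have "r * w \<le> r * c ^ k" using wb r by (intro mult_left_mono) auto
      then show "t \<in> {r * w..<w}" using tb wb by (simp add: c2[symmetric] mult.assoc)
    qed
    ultimately show "\<P>(\<omega> in M. \<exists>t\<in>F. X t \<omega> \<in> near e t) \<le> 2 * hit_prob (3 * e) w"
      using wb k0 F by (intro hit) auto
  qed
  define a where "a k = (if k0 \<le> k then prob (H (Suc k)) / 2 else 0)" for k
  have a: "0 \<le> a k" for k by (simp add: a_def)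
  have "(\<Sum>k. ennreal ((1 - c) * a k)) =
      (\<integral>\<^sup>+t. (\<Sum>k. ennreal (a k / c ^ k) * indicator (geo_ivl c k) t) \<partial>lborel)"
    by (rule nn_integral_geo_steps[OF c a, symmetric])
  also have "\<dots> \<le> (\<integral>\<^sup>+ t. indicator {0<..1} t * ennreal (hit_prob (3 * e) t / t) \<partial>lborel)"
  proof (rule nn_integral_mono)
    fix t
    show "(\<Sum>k. ennreal (a k / c ^ k) * indicator (geo_ivl c k) t) \<le> indicator {0<..1} t * ennreal (hit_prob (3 * e) t / t)"
    proof (cases "t \<in> {0<..1}")
      case True
      then obtain k where k: "t \<in> geo_ivl c k" using geo_ivl_exists[OF c, of t] by auto
      note tb = geo_ivl_bounds[OF c k]
      have "a k \<le> hit_prob (3 * e) t" using le[OF _ k] by (auto simp: a_def)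
      then have "a k / c ^ k \<le> hit_prob (3 * e) t / t"
        using tb a by (intro frac_le) auto
      then show ?thesis
        unfolding suminf_geo_ivl_eq[OF c k] using True by (simp add: ennreal_leI)
    qed (simp add: suminf_geo_ivl_eq_0[OF c])
  qed
  finally have "(\<Sum>k. ennreal ((1 - c) * a k)) \<noteq> \<top>" using fin by (auto simp: top_unique)
  then have "summable (\<lambda>k. (1 - c) * a k)"
    using a c by (intro summable_suminf_not_top) auto
  then have "summable a" using c by simp
  then have "summable (\<lambda>k. 2 * a (k + k0))"
    by (intro summable_mult) (simp add: summable_iff_shift)
  then have "summable (\<lambda>k. prob (H (k + Suc k0)))" by (simp add: a_def)
  then have "summable (\<lambda>k. prob (H k))" by (rule summable_iff_shift[THEN iffD1])
  then have ev: "AE \<omega> in M. eventually (\<lambda>k. \<omega> \<in> space M - H k) sequentially"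
    using Hm by (intro borel_cantelli_AE1) (auto simp: less_top[symmetric])
  have rc: "AE \<omega> in M. \<forall>t\<ge>0. continuous (at_right t) (\<lambda>s. X s \<omega>)"
    using levy by (auto simp: levy_process_def)
  show ?thesis
    using ev rc
  proof eventually_elim
    case (elim \<omega>)
    then obtain N where N: "\<And>k. N \<le> k \<Longrightarrow> \<omega> \<in> space M - H k"
      by (auto simp: eventually_sequentially)
    have False if x: "x \<in> cluster_set_at0 (\<lambda>t. (1 / b t) *\<^sub>R X t \<omega>)"
    proof -
      obtain \<tau> where "\<forall>n::nat. 0 < \<tau> n" and \<tau>: "\<tau> \<longlonglongrightarrow> 0" "(\<lambda>n. (1 / b (\<tau> n)) *\<^sub>R X (\<tau> n) \<omega>) \<longlonglongrightarrow> x"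
        using x unfolding cluster_set_at0_def mem_Collect_eq by (elim exE conjE)
      then have \<tau>_pos: "0 < \<tau> n" for n by simp
      have "eventually (\<lambda>n. \<tau> n < c ^ Suc N) sequentially"
        using c by (intro order_tendstoD(2)[OF \<tau>(1)]) auto
      moreover have "eventually (\<lambda>n. dist ((1 / b (\<tau> n)) *\<^sub>R X (\<tau> n) \<omega>) x < e) sequentially"
        by (rule tendstoD[OF \<tau>(2) \<open>0 < e\<close>])
      ultimately obtain n where n: "\<tau> n < c ^ Suc N" "dist ((1 / b (\<tau> n)) *\<^sub>R X (\<tau> n) \<omega>) x < e"
        by (metis (mono_tags, lifting) eventually_conj_iff eventually_sequentially order_refl)
      define t where "t = \<tau> n"
      have "c ^ Suc N \<le> c" using c power_decreasing[of 1 "Suc N" c] by simp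
      then have "t < 1" using n c unfolding t_def by linarith
      have t: "0 < t" "X t \<omega> \<in> near e t"
        using \<tau>_pos[of n] n by (auto simp: t_def hit_set_def dist_norm)
      obtain k where k: "t \<in> geo_ivl c k" using geo_ivl_exists[OF c, of t] t \<open>t < 1\<close> by auto
      note tb = geo_ivl_bounds[OF c k]
      have "c ^ Suc k < c ^ Suc N" using tb n by (simp add: t_def)
      then have "N \<le> k" using c by (metis power_decreasing_iff not_less Suc_le_mono nat_le_linear)
      then have nH: "\<omega> \<in> space M" "\<omega> \<notin> H k" using N by auto
      show False
      proof (cases "t = c ^ k")
        case True
        then show False using nH t by (auto simp: H_def C_def)
      next
        \<comment> \<open>Strictly inside the interval, the open hit condition persists immediately
          to the right of \<open>t\<close>, so a rational time of the same interval is a hit as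
          well.\<close>
        case False
        then have "t < c ^ k" using tb by simp
        define g where "g s = norm ((1 / b s) *\<^sub>R X s \<omega> - x)" for s
        have "continuous (at_right t) (\<lambda>s. X s \<omega>)" using elim(2) t by simp
        moreover have "continuous (at_right t) b"
          using b_cont[of t] t \<open>t < 1\<close> continuous_at_imp_continuous_at_within by blast
        ultimately have "continuous (at_right t) g"
          unfolding g_def using b_pos[of t] t \<open>t < 1\<close> by (intro continuous_intros) auto
        then have "(g \<longlongrightarrow> g t) (at_right t)" by (simp add: continuous_within)
        then have "eventually (\<lambda>s. g s < e) (at_right t)"
          by (rule order_tendstoD(2)) (use t in \<open>simp add: g_def hit_set_def\<close>)
        moreover have "eventually (\<lambda>s. s \<in> {t<..<c ^ k}) (at_right t)"
          by (rule eventually_at_right_real) fact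
        ultimately have "eventually (\<lambda>s. g s < e \<and> s \<in> {t<..<c ^ k}) (at_right t)"
          by (rule eventually_conj)
        then obtain d where d: "t < d" "\<And>s. t < s \<Longrightarrow> s < d \<Longrightarrow> g s < e \<and> s \<in> {t<..<c ^ k}"
          by (auto simp: eventually_at_right_field)
        obtain q where q: "q \<in> \<rat>" "t < q" "q < d" using Rats_dense_in_real[OF \<open>t < d\<close>] by auto
        have "q \<in> C k" using d(2)[OF q(2,3)] q(1) tb by (auto simp: C_def geo_ivl_def)
        moreover have "X q \<omega> \<in> near e q" using d(2)[OF q(2,3)] by (simp add: g_def hit_set_def)
        ultimately show False using nH by (auto simp: H_def)
      qed
    qed
    then show ?case by blast
  qed
qed

section \<open>Divergent integrals: almost sure clustering at \<open>x\<close>\<close>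

lemma ex_hitting_event:
  assumes "0 < e" "0 < d" "d < 1" "0 < z"
    and inf: "(\<integral>\<^sup>+ t. indicator {0<..1} t * ennreal (hit_prob e t / t) \<partial>lborel) = \<infinity>"
  shows "\<exists>H\<in>sets M. (1 - d)\<^sup>2 \<le> prob H \<and> (\<forall>\<omega>\<in>H. \<exists>t. 0 < t \<and> t < z \<and> X t \<omega> \<in> near (3 * e) t)"
proof -
  obtain c0 \<eta> where c0: "0 < c0" "c0 \<le> 1/2" and \<eta>: "0 < \<eta>" "\<eta> \<le> 1" "\<eta> \<le> z / 2"
    and P: "\<And>h t. 0 < h \<Longrightarrow> h \<le> c0 * t \<Longrightarrow> t \<le> \<eta> \<Longrightarrow> 1 - d \<le> \<P>(\<omega> in M. norm (X h \<omega>) \<le> e * b t)"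
    and N: "\<And>s t y w. (1 - c0) * t \<le> s \<Longrightarrow> 0 < s \<Longrightarrow> s \<le> t \<Longrightarrow> t \<le> \<eta> \<Longrightarrow>
       y \<in> near e s \<Longrightarrow> norm w \<le> e * b t \<Longrightarrow> y + w \<in> near (3 * e) t"
    using small_time_constants[OF \<open>0 < e\<close> \<open>0 < d\<close>, of "z / 2"] \<open>0 < z\<close> by auto
  \<comment> \<open>The tail bound \<open>2 * c * v k\<close> for \<open>T (Suc k)\<close> becomes
    \<open>c0 * v k\<close>. Likewise \<open>v 0 \<le> \<eta> / 2\<close> below keeps every
    \<open>T k\<close> at most \<open>\<eta>\<close>.\<close>
  define c where "c = c0 / 2"
  have c: "0 < c" "c \<le> 1/2" "c < 1" using c0 by (auto simp: c_def)
  obtain v where v: "v 0 \<le> \<eta> / 2" "\<And>k. 0 < v k" "\<And>k. v (Suc k) \<le> c * v k" "\<not> summable (\<lambda>k::nat. hit_prob e (v k))"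
    using ex_geometric_not_summable[OF _ _ c(1,3) _ inf, of "\<eta> / 2"] \<eta> by auto
  define T where "T k = (\<Sum>j. v (k + j))" for k
  note T = geometric_tails[of c v, OF c(1,2) v(2,3), folded T_def]
  have T_less: "T (Suc k) < T k" for k using T(1)[of k] v(2)[of k] by simp
  have T_le: "T k \<le> \<eta>" for k using T(4)[of k] v(1) by simp
  have T_small: "T (Suc k) \<le> c0 * T k" for k
  proof -
    have "T (Suc k) \<le> c0 * v k" using T(3)[of k] by (simp add: c_def)
    also have "\<dots> \<le> c0 * T k" using T(1)[of k] T(2)[of "Suc k"] c0 by (intro mult_left_mono) auto
    finally show ?thesis .
  qed
  define a where "a k = hit_prob e (v k)" for k
  have a: "0 \<le> a k" "a k \<le> 1" for k by (auto simp: a_def)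
  define B where "B k = cball (0::'b) (e * b (T k))" for k
  define A where "A k = near e (v k)" for k
  \<comment> \<open>\<open>F j\<close> says that trial \<open>j\<close> is the first success,
    counted from the largest time, and that the remainder \<open>X (T (Suc j))\<close> is small.
    These events are disjoint, and the trials up to \<open>j\<close> are independent of that
    remainder.\<close>
  define S where "S j i = (if i = j then A j else - A i)" for j i
  define F where "F j = {\<omega>\<in>space M. X (T (Suc j)) \<omega> \<in> B j \<and>
     (\<forall>i\<le>j. X (T i) \<omega> - X (T (Suc i)) \<omega> \<in> S j i)}" for j
  have [measurable]: "X (T k) \<in> borel_measurable M" "X (v k) \<in> borel_measurable M" for k
    using T(2)[of k] v(2)[of k] by auto
  have [measurable]: "A k \<in> sets borel" "B k \<in> sets borel" "S j k \<in> sets borel" for j k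
    by (auto simp: A_def B_def S_def)
  have Fm: "F j \<in> sets M" for j
    unfolding F_def by measurable
  have PF: "(1 - d) * ((\<Prod>i<j. 1 - a i) * a j) \<le> prob (F j)" for j
  proof -
    have diff: "T i - T (Suc i) = v i" for i using T(1)[of i] by simp
    have neg: "\<P>(\<omega> in M. X (v i) \<omega> \<in> - A i) = 1 - a i" for i
      unfolding a_def A_def[symmetric] Compl_iff by (rule prob_neg) measurable
    have "prob (F j) = \<P>(\<omega> in M. X (T (Suc j)) \<omega> \<in> B j) *
        (\<Prod>i\<le>j. \<P>(\<omega> in M. X (T i - T (Suc i)) \<omega> \<in> S j i))"
      unfolding F_def by (rule prob_increments) (use T(2) T_less in auto)
    also have "(\<Prod>i\<le>j. \<P>(\<omega> in M. X (T i - T (Suc i)) \<omega> \<in> S j i)) =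
        (\<Prod>i<j. 1 - a i) * a j"
      unfolding lessThan_Suc_atMost[symmetric] diff using neg by (simp add: a_def A_def S_def)
    finally have "prob (F j) = \<P>(\<omega> in M. X (T (Suc j)) \<omega> \<in> B j) * ((\<Prod>i<j. 1 - a i) * a j)" .
    moreover have "1 - d \<le> \<P>(\<omega> in M. X (T (Suc j)) \<omega> \<in> B j)"
      using P[OF T(2)[of "Suc j"] T_small T_le] by (simp add: B_def)
    moreover have "0 \<le> (\<Prod>i<j. 1 - a i) * a j"
      using a by (simp add: prod_nonneg)
    ultimately show ?thesis by (simp add: mult_right_mono)
  qed
  obtain n where n: "(\<Prod>i<n. 1 - a i) \<le> d"
    using prod_one_minus_small[of a d] a v(4) \<open>0 < d\<close> unfolding a_def by blast
  define H where "H = (\<Union>j<n. F j)"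
  have "F i \<inter> F j = {}" if "i < j" for i j
    using that by (force simp: F_def S_def)
  then have disj: "disjoint_family_on F {..<n}"
    unfolding disjoint_family_on_def by (metis Int_commute linorder_neqE_nat)
  \<comment> \<open>One factor \<open>1 - d\<close> is for a small remainder, the other for a
    success among the first \<open>n\<close> trials.\<close>
  have "(1 - d)\<^sup>2 \<le> (1 - d) * (1 - (\<Prod>i<n. 1 - a i))"
    unfolding power2_eq_square using n \<open>d < 1\<close> by (intro mult_left_mono) auto
  also have "\<dots> = (\<Sum>j<n. (1 - d) * ((\<Prod>i<j. 1 - a i) * a j))"
    by (simp add: sum_first_success sum_distrib_left[symmetric])
  also have "\<dots> \<le> (\<Sum>j<n. prob (F j))" by (intro sum_mono PF)
  also have "\<dots> = prob H"
    unfolding H_def using Fm disj by (intro finite_measure_finite_Union[symmetric]) auto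
  finally have "(1 - d)\<^sup>2 \<le> prob H" .
  moreover have "H \<in> sets M" using Fm by (auto simp: H_def)
  moreover have "\<exists>t. 0 < t \<and> t < z \<and> X t \<omega> \<in> near (3 * e) t" if \<omega>: "\<omega> \<in> H" for \<omega>
  proof -
    obtain j where "\<omega> \<in> F j" using \<omega> by (auto simp: H_def)
    then have w: "norm (X (T (Suc j)) \<omega>) \<le> e * b (T j)" and y: "X (T j) \<omega> - X (T (Suc j)) \<omega> \<in> near e (v j)"
      by (auto simp: F_def S_def A_def B_def)
    have "(X (T j) \<omega> - X (T (Suc j)) \<omega>) + X (T (Suc j)) \<omega> \<in> near (3 * e) (T j)"
      by (rule N[OF _ v(2) _ T_le y w])
        (use T(1)[of j] T_small[of j] T(2)[of "Suc j"] in \<open>auto simp: algebra_simps\<close>)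
    then show ?thesis
      using T(2)[of j] T_le[of j] \<eta>(3) \<open>0 < z\<close> by (intro exI[of _ "T j"]) auto
  qed
  ultimately show ?thesis by blast
qed

text \<open>A hit at some time before \<open>z\<close> is an uncountable union, so measurable events
  inside it are used: their probabilities approach \<open>1\<close>, and their countable union has
  probability \<open>1\<close>. Running through \<open>e = z = 1 / Suc n\<close> then produces a
  sequence of times witnessing the cluster point.\<close>

lemma AE_cluster:
  assumes inf: "\<And>e. 0 < e \<Longrightarrow> (\<integral>\<^sup>+ t. indicator {0<..1} t * ennreal (hit_prob e t / t) \<partial>lborel) = \<infinity>"
  shows "AE \<omega> in M. x \<in> cluster_set_at0 (\<lambda>t. (1 / b t) *\<^sub>R X t \<omega>)"
proof -
  have "AE \<omega> in M. \<exists>t. 0 < t \<and> t < z \<and> X t \<omega> \<in> near e t" if "0 < e" "0 < z" for e z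
  proof -
    define d where "d m = 1 / real (m + 2)" for m :: nat
    have "0 < d m" "d m < 1" for m by (auto simp: d_def)
    then have "\<exists>H\<in>sets M. (1 - d m)\<^sup>2 \<le> prob H \<and> (\<forall>\<omega>\<in>H. \<exists>t. 0 < t \<and> t < z \<and> X t \<omega> \<in> near (3 * (e / 3)) t)" for m
      using that inf by (intro ex_hitting_event) auto
    then obtain H where H: "\<And>m. H m \<in> sets M" "\<And>m. (1 - d m)\<^sup>2 \<le> prob (H m)"
      "\<And>m \<omega>. \<omega> \<in> H m \<Longrightarrow> \<exists>t. 0 < t \<and> t < z \<and> X t \<omega> \<in> near e t"
      by (auto; metis)
    have "(\<lambda>m. (1 - d m)\<^sup>2) \<longlonglongrightarrow> (1 - 0)\<^sup>2"
      unfolding d_def by (intro tendsto_intros LIMSEQ_ignore_initial_segment lim_1_over_n)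
    moreover have "(1 - d m)\<^sup>2 \<le> prob (\<Union>m. H m)" for m
      by (rule order_trans[OF H(2) finite_measure_mono]) (use H(1) in auto)
    ultimately have "(1 - 0)\<^sup>2 \<le> prob (\<Union>m. H m)"
      by (intro LIMSEQ_le_const2) auto
    then have "prob (\<Union>m. H m) = 1" by (intro antisym prob_le_1) simp
    then have "AE \<omega> in M. \<omega> \<in> (\<Union>m. H m)"
      using H(1) by (subst (asm) prob_eq_1) auto
    then show ?thesis by eventually_elim (use H(3) in blast)
  qed
  then have "AE \<omega> in M. \<forall>n::nat. \<exists>t. 0 < t \<and> t < 1 / Suc n \<and> X t \<omega> \<in> near (1 / Suc n) t"
    unfolding AE_all_countable by simp
  then show ?thesis
  proof eventually_elim
    case (elim \<omega>)
    then obtain \<tau> where \<tau>: "\<And>n::nat. 0 < \<tau> n" "\<And>n. \<tau> n < 1 / Suc n" "\<And>n. X (\<tau> n) \<omega> \<in> near (1 / Suc n) (\<tau> n)"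
      by metis
    have lim: "(\<lambda>n. 1 / real (Suc n)) \<longlonglongrightarrow> 0"
      using LIMSEQ_Suc[OF lim_1_over_n] by simp
    have "\<tau> \<longlonglongrightarrow> 0"
      by (rule tendsto_sandwich[OF _ _ tendsto_const lim])
        (use \<tau>(1,2) less_imp_le in \<open>auto intro!: always_eventually\<close>)
    moreover have "(\<lambda>n. (1 / b (\<tau> n)) *\<^sub>R X (\<tau> n) \<omega>) \<longlonglongrightarrow> x"
    proof (rule metric_tendsto_imp_tendsto[OF lim])
      show "\<forall>\<^sub>F n in sequentially. dist ((1 / b (\<tau> n)) *\<^sub>R X (\<tau> n) \<omega>) x \<le> dist (1 / real (Suc n)) 0"
        using \<tau>(3) less_imp_le by (auto simp: hit_set_def dist_norm intro!: always_eventually)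
    qed
    ultimately show ?case using \<tau>(1) by (auto simp: cluster_set_at0_def)
  qed
qed

lemma AE_cluster_iff:
  "(AE \<omega> in M. x \<in> cluster_set_at0 (\<lambda>t. (1 / b t) *\<^sub>R X t \<omega>)) \<longleftrightarrow>
   (\<forall>e>0. (\<integral>\<^sup>+ t. indicator {0<..1} t * ennreal (hit_prob e t / t) \<partial>lborel) = \<infinity>)"
proof (intro iffI allI impI)
  fix e :: real
  assume cl: "AE \<omega> in M. x \<in> cluster_set_at0 (\<lambda>t. (1 / b t) *\<^sub>R X t \<omega>)" and "0 < e"
  show "(\<integral>\<^sup>+ t. indicator {0<..1} t * ennreal (hit_prob e t / t) \<partial>lborel) = \<infinity>"
  proof (rule ccontr)
    assume "\<not> ?thesis"
    then have "AE \<omega> in M. x \<notin> cluster_set_at0 (\<lambda>t. (1 / b t) *\<^sub>R X t \<omega>)"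
      using \<open>0 < e\<close> by (intro AE_not_cluster[of "e / 3"]) auto
    with cl have "AE \<omega> in M. False" by eventually_elim blast
    then show False by simp
  qed
qed (use AE_cluster in blast)

end

section \<open>Deriving the abstract conditions from the hypotheses on \<open>b\<close>\<close>

theorem theorem5p2:
  fixes M :: "'a measure"
    and X :: "real \<Rightarrow> 'a \<Rightarrow> real ^ 'd"
    and b :: "real \<Rightarrow> real"
    and x :: "real ^ 'd"
  assumes levy: "levy_process M X"
    and b_cont: "continuous_on {0..1} b"
    and b_mono: "mono_on {0..1} b"
    and b_range: "b ` {0..1} \<subseteq> {0..1}"
    and b_one: "b 1 = 1"
    and b_lim: "filterlim (\<lambda>t. b t / t) at_top (at_right 0)"
    and b_reg: "\<exists>t0>0. (\<exists>\<rho>>1/3. mono_on {0<..t0} (\<lambda>t. b t / t powr \<rho>))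
                  \<and> (\<forall>\<epsilon>>0. \<exists>\<delta>. 0 < \<delta> \<and> \<delta> < t0 \<and>
                        (\<forall>s t. 0 \<le> s \<and> s \<le> t \<and> t \<le> \<delta> \<and> 0 < t \<longrightarrow>
                           b s / b t \<ge> (1 - \<epsilon>) * s / t))"
    and tight: "\<forall>\<delta>>0. \<exists>K>0. \<exists>t\<delta>. 0 < t\<delta> \<and> t\<delta> < 1 \<and>
                  (\<forall>t. 0 < t \<and> t < t\<delta> \<longrightarrow>
                     measure M {\<omega> \<in> space M. norm (X t \<omega>) > K * b t} < \<delta>)"
  shows "(AE \<omega> in M. x \<in> cluster_set_at0 (\<lambda>t. (1 / b t) *\<^sub>R X t \<omega>))
     \<longleftrightarrow> (\<forall>\<epsilon>>0. (\<integral>\<^sup>+ t. indicator {0<..1} t *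
              ennreal (measure M {\<omega> \<in> space M. norm ((1 / b t) *\<^sub>R X t \<omega> - x) < \<epsilon>} / t)
            \<partial>lborel) = \<infinity>)"
proof -
  interpret prob_space M using levy by (simp add: levy_process_def)
  obtain t0 \<rho> where t0: "0 < t0" "1/3 < \<rho>" and reg1: "mono_on {0<..t0} (\<lambda>t. b t / t powr \<rho>)"
    and reg2: "\<And>\<epsilon>. 0 < \<epsilon> \<Longrightarrow> \<exists>\<delta>. 0 < \<delta> \<and> \<delta> < t0 \<and>
                        (\<forall>s t. 0 \<le> s \<and> s \<le> t \<and> t \<le> \<delta> \<and> 0 < t \<longrightarrow>
                           b s / b t \<ge> (1 - \<epsilon>) * s / t)"
    using b_reg by blast
  have mono: "b s \<le> b t" if "0 < s" "s \<le> t" "t \<le> 1" for s t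
    using monotone_onD[OF b_mono, of s t] that by simp
  have pos: "0 < b t" if "0 < t" "t \<le> 1" for t
  proof -
    \<comment> \<open>The divergence of \<open>b s / s\<close> gives positive values of
      \<open>b\<close> at arbitrarily small times, and monotonicity carries them to
      \<open>t\<close>.\<close>
    have "eventually (\<lambda>s. 0 < b s / s) (at_right 0)"
      using b_lim by (simp add: filterlim_at_top_dense)
    moreover have "eventually (\<lambda>s. s \<in> {0<..<t}) (at_right 0)"
      by (rule eventually_at_right_real) fact
    ultimately have "eventually (\<lambda>s. 0 < b s / s \<and> s \<in> {0<..<t}) (at_right 0)"
      by (rule eventually_conj)
    then obtain s where "0 < b s / s" "0 < s" "s < t"
      using eventually_happens'[OF trivial_limit_at_right_real] by force
    then show ?thesis using mono[of s t] that by (simp add: zero_less_divide_iff)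
  qed
  have small: "\<exists>c>0. \<exists>\<eta>>0. \<eta> \<le> 1 \<and> (\<forall>h t. 0 < h \<longrightarrow> h \<le> c * t \<longrightarrow> t \<le> \<eta> \<longrightarrow> K * b h \<le> e * b t)"
    if "0 < K" "0 < e" for K e
  proof (intro exI conjI allI impI)
    \<comment> \<open>Monotonicity of \<open>b t / t powr \<rho>\<close> gives
      \<open>b h \<le> (h / t) powr \<rho> * b t\<close>; the choice of \<open>c\<close> makes the
      factor at most \<open>e / K\<close>.\<close>
    define c where "c = min 1 ((e / K) powr (1 / \<rho>))"
    show "0 < c" using that by (simp add: c_def)
    show "0 < min t0 1" "min t0 1 \<le> 1" using t0 by auto
    fix h t assume h: "0 < h" "h \<le> c * t" "t \<le> min t0 1"
    have "0 < t" using h \<open>0 < c\<close> by (smt (verit) mult_nonneg_nonpos)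
    then have "c * t \<le> 1 * t" by (intro mult_right_mono) (auto simp: c_def)
    then have "h \<le> t" using h by simp
    have "b h / h powr \<rho> \<le> b t / t powr \<rho>"
      using monotone_onD[OF reg1, of h t] h \<open>h \<le> t\<close> by simp
    then have "b h \<le> (h / t) powr \<rho> * b t"
      using h \<open>0 < t\<close> by (simp add: field_simps powr_divide)
    also have "(h / t) powr \<rho> \<le> ((e / K) powr (1 / \<rho>)) powr \<rho>"
    proof (rule powr_mono2)
      have "h / t \<le> c" using h \<open>0 < t\<close> by (simp add: field_simps)
      then show "h / t \<le> (e / K) powr (1 / \<rho>)" by (simp add: c_def)
    qed (use t0 h \<open>0 < t\<close> in auto)
    also have "\<dots> = e / K" using t0 that by (simp add: powr_powr)
    finally have "b h \<le> e / K * b t"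
      using pos[of t] \<open>0 < t\<close> h by (simp add: mult_right_mono)
    then show "K * b h \<le> e * b t" using that by (simp add: field_simps)
  qed
  have near: "\<exists>c>0. \<exists>\<eta>>0. \<eta> \<le> 1 \<and>
      (\<forall>s t. (1 - c) * t \<le> s \<longrightarrow> 0 < s \<longrightarrow> s \<le> t \<longrightarrow> t \<le> \<eta> \<longrightarrow> (1 - e) * b t \<le> b s)"
    if "0 < e" for e
  proof -
    \<comment> \<open>The same \<open>c\<close> bounds the time ratio and serves as the tolerance in
      the regularity condition, so the loss is \<open>(1 - c) * (1 - c)\<close>, at least
      \<open>1 - 2 * c\<close> and hence at least \<open>1 - e\<close>.\<close>
    define c where "c = min 1 (e / 2)"
    have c: "0 < c" "c \<le> 1" "2 * c \<le> e" using that by (auto simp: c_def)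
    obtain \<delta> where \<delta>: "0 < \<delta>" "\<And>s t. 0 \<le> s \<Longrightarrow> s \<le> t \<Longrightarrow> t \<le> \<delta> \<Longrightarrow> 0 < t \<Longrightarrow> (1 - c) * s / t \<le> b s / b t"
      using reg2[OF c(1)] by blast
    have "(1 - e) * b t \<le> b s" if st: "(1 - c) * t \<le> s" "0 < s" "s \<le> t" "t \<le> min \<delta> 1" for s t
    proof -
      have bt: "0 < b t" using pos[of t] st by simp
      have "(1 - e) \<le> (1 - c) * (1 - c)" using c by (simp add: algebra_simps add_increasing2)
      also have "\<dots> \<le> (1 - c) * (s / t)" using st c by (intro mult_left_mono) (auto simp: field_simps)
      also have "\<dots> \<le> b s / b t" using \<delta>(2)[of s t] st by simp
      finally show ?thesis using bt by (simp add: field_simps)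
    qed
    then show ?thesis
      using c \<delta>(1) by (intro exI[of _ c] conjI exI[of _ "min \<delta> 1"]) auto
  qed
  interpret normalized_levy M X b x
  proof
    show "isCont b t" if "0 < t" "t < 1" for t
      using continuous_on_interior[OF b_cont, of t] that by simp
    show "\<exists>K>0. \<exists>\<eta>>0. \<forall>t. 0 < t \<longrightarrow> t < \<eta> \<longrightarrow> \<P>(\<omega> in M. K * b t < norm (X t \<omega>)) < d" if d: "0 < d" for d
    proof -
      obtain K t1 where "0 < K" "0 < t1" "\<forall>t. 0 < t \<and> t < t1 \<longrightarrow> \<P>(\<omega> in M. K * b t < norm (X t \<omega>)) < d"
        using tight[rule_format, OF d] by (elim exE conjE)
      then show ?thesis by (intro exI[of _ K] exI[of _ t1] conjI) simp_all
    qed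
  qed (use levy mono pos small near in auto)
  show ?thesis
    using AE_cluster_iff by (simp add: hit_set_def)
qed

end
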